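(* Let $n,r,k$ be integers with $n\ge r\ge 1$. If $0<k\le\frac{1}{3}r!$, then $f(n,r,k)=r$.
   Context: An $r$-digraph $G$ consists of a finite vertex set $V(G)$ and an edge set $E(G)$ whose elements are ordered lists of $r$ distinct vertices. An $(r,k)$-tournament is an $r$-digraph $G$ such that for every $r$-element set $S\subseteq V(G)$, exactly $k$ of the $r!$ orderings of $S$ are edges of $G$. The tight path $P^{(r)}_s$ is the $r$-digraph with $s$ distinct vertices $v_1,\ldots,v_s$ whose edges are exactly the lists of $r$ consecutive vertices $(v_i,v_{i+1},\ldots,v_{i+r-1})$, $1\le i\le s-r+1$ (so it has no edges if $s<r$). An $r$-digraph $G$ contains $P^{(r)}_s$ if there is an injection of its vertices into $V(G)$ mapping edges to edges (not necessarily induced). $f(n,r,k)$ is the maximum integer $s$ such that every $n$-vertex $(r,k)$-tournament contains a copy of $P^{(r)}_s$. *)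

theory Defs
  imports Complex_Main "HOL-Combinatorics.Multiset_Permutations"
begin

record 'a hyperdigraph =
  verts :: "'a set"
  edges :: "'a list set"

definition r_digraph :: "nat \<Rightarrow> 'a hyperdigraph \<Rightarrow> bool" where
  "r_digraph r G \<longleftrightarrow>
     finite (verts G) \<and>
     (\<forall>e \<in> edges G. length e = r \<and> distinct e \<and> set e \<subseteq> verts G)"

definition tournament :: "nat \<Rightarrow> nat \<Rightarrow> 'a hyperdigraph \<Rightarrow> bool" where
  "tournament r k G \<longleftrightarrow>
     r_digraph r G \<and>
     (\<forall>S. S \<subseteq> verts G \<and> card S = r \<longrightarrow> card (permutations_of_set S \<inter> edges G) = k)"

(* The vertices v_1, ..., v_s are represented by 0, ..., s - 1. *)
definition tight_path :: "nat \<Rightarrow> nat \<Rightarrow> nat hyperdigraph" where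
  "tight_path r s = \<lparr>verts = {..<s}, edges = {[i..<i + r] | i. i + r \<le> s}\<rparr>"

definition contains :: "'a hyperdigraph \<Rightarrow> 'b hyperdigraph \<Rightarrow> bool" where
  "contains G H \<longleftrightarrow>
     (\<exists>\<phi>. inj_on \<phi> (verts H) \<and> \<phi> ` verts H \<subseteq> verts G \<and>
          (\<forall>e \<in> edges H. map \<phi> e \<in> edges G))"

(* Every finite r-digraph is isomorphic to one whose vertices are natural
   numbers, so it suffices to quantify over the latter.  If k > r! and n \<ge> r
   there is no n-vertex (r,k)-tournament, hence no maximum, and the value is
   unspecified; for k \<le> r! the admissible s are bounded by n. *)
definition f :: "nat \<Rightarrow> nat \<Rightarrow> nat \<Rightarrow> nat" where
  "f n r k =
     (GREATEST s. \<forall>G :: nat hyperdigraph.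
        tournament r k G \<and> card (verts G) = n \<longrightarrow> contains G (tight_path r s))"

end

(* Orient every r-set only by orderings whose second entry is the largest of the first
   three; a third of all orderings have this property. If both v_1 ... v_r and
   v_2 ... v_(r+1) were such edges, then v_3 < v_2 and v_2 < v_3. So no tight path with
   more than r vertices occurs, while a single edge is one with r vertices. *)
theory Submission imports Defs begin

definition second_peak :: "'a::linorder list \<Rightarrow> bool" where
  "second_peak xs \<longleftrightarrow> xs ! 0 < xs ! 1 \<and> xs ! 2 < xs ! 1"

text \<open>On distinct lists of length at least 3 its orbits have three members, exactly one of
  which satisfies \<open>second_peak\<close>. This is the source of the fraction 1/3.\<close>

definition rotate_three :: "'a list \<Rightarrow> 'a list" where
  "rotate_three xs = xs ! 1 # xs ! 2 # xs ! 0 # drop 3 xs"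

text \<open>Rotating the first three entries brings their maximum to each of the three positions. So
  the good orderings and their images under one and two rotations cover all orderings, and no image
  is larger than the original set.\<close>

lemma fact_le_three_card_second_peak:
  assumes "finite S" and "card S \<ge> 3"
  shows "fact (card S) \<le> 3 * card {xs \<in> permutations_of_set S. second_peak xs}"
proof -
  let ?A = "{xs \<in> permutations_of_set S. second_peak xs}"
  let ?B = "rotate_three ` ?A"
  let ?C = "rotate_three ` ?B"
  have fin: "finite ?A" by simp
  have "permutations_of_set S \<subseteq> ?A \<union> ?B \<union> ?C"
  proof
    fix xs assume xs: "xs \<in> permutations_of_set S"
    then have S: "set xs = S" "distinct xs" by (auto simp: permutations_of_set_def)
    then have "length xs \<ge> 3" using assms(2) distinct_card by metis
    then obtain x y z w where eq: "xs = x # y # z # w"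
      by (auto simp: numeral_3_eq_3 Suc_le_length_iff)
    have "xs \<in> ?A" if "x < y" "z < y"
      using that xs eq by (simp add: second_peak_def)
    \<comment> \<open>The witness undoes one rotation, which moves the maximum \<open>x\<close> from
      first to second place. When \<open>z\<close> is the maximum, two rotations have to be
      undone.\<close>
    moreover have "xs \<in> ?B" if "y < x" "z < x"
    proof (rule image_eqI)
      show "xs = rotate_three (z # x # y # w)" by (simp add: eq rotate_three_def)
      show "z # x # y # w \<in> ?A"
        using that S eq by (auto simp: second_peak_def permutations_of_set_def)
    qed
    moreover have "xs \<in> ?C" if "x < z" "y < z"
    proof (intro image_eqI)
      show "xs = rotate_three (z # x # y # w)" by (simp add: eq rotate_three_def)
      show "z # x # y # w = rotate_three (y # z # x # w)" by (simp add: rotate_three_def)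
      show "y # z # x # w \<in> ?A"
        using that S eq by (auto simp: second_peak_def permutations_of_set_def)
    qed
    ultimately show "xs \<in> ?A \<union> ?B \<union> ?C"
      using S(2) eq by (auto simp: neq_iff)
  qed
  then have "fact (card S) \<le> card (?A \<union> ?B \<union> ?C)"
    using fin assms(1) by (metis (no_types, lifting) card_mono card_permutations_of_set finite_UnI finite_imageI)
  also have "\<dots> \<le> card ?A + card ?B + card ?C"
    by (meson add_le_mono1 card_Un_le order_trans)
  also have "\<dots> \<le> 3 * card ?A"
    using card_image_le[OF fin, of rotate_three]
      card_image_le[OF finite_imageI[OF fin, of rotate_three], of rotate_three] by linarith
  finally show ?thesis .
qed

text \<open>An ordering determines its underlying set, so the \<open>k\<close> edges on each
  \<open>r\<close>-set can be chosen independently among the orderings satisfying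
  \<open>P\<close>.\<close>

lemma tournament_from_orderings:
  assumes "finite V"
    and "\<And>S. S \<subseteq> V \<Longrightarrow> card S = r \<Longrightarrow> k \<le> card {xs \<in> permutations_of_set S. P xs}"
  obtains G where "tournament r k G" and "verts G = V" and "\<And>xs. xs \<in> edges G \<Longrightarrow> P xs"
proof -
  have "\<exists>T. T \<subseteq> {xs \<in> permutations_of_set S. P xs} \<and> card T = k"
    if "S \<subseteq> V" "card S = r" for S
    using obtain_subset_with_card_n[OF assms(2)[OF that]] by metis
  then obtain T where T: "T S \<subseteq> {xs \<in> permutations_of_set S. P xs}" "card (T S) = k"
    if "S \<subseteq> V" "card S = r" for S by metis
  \<comment> \<open>\<open>T\<close> is specified only on \<open>r\<close>-subsets of
    \<open>V\<close>; the first two conditions confine the edges to these sets.\<close>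
  define G where "G = \<lparr>verts = V, edges = {xs. set xs \<subseteq> V \<and> card (set xs) = r \<and> xs \<in> T (set xs)}\<rparr>"
  have edge: "distinct xs \<and> P xs" if "xs \<in> edges G" for xs
    using that T(1)[of "set xs"] by (auto simp: G_def permutations_of_set_def)
  show ?thesis
  proof
    have "r_digraph r G"
      using edge assms(1) distinct_card by (fastforce simp: r_digraph_def G_def)
    moreover have "permutations_of_set S \<inter> edges G = T S" if "S \<subseteq> V" "card S = r" for S
      using that T(1)[OF that] by (auto simp: G_def permutations_of_set_def)
    ultimately show "tournament r k G"
      using T(2) by (simp add: tournament_def G_def)
  qed (use edge in \<open>auto simp: G_def\<close>)
qed

lemma tournament_contains_edge:
  assumes "tournament r k G" and "0 < k" and "r \<le> card (verts G)" and "r \<ge> 1"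
  shows "contains G (tight_path r r)"
proof -
  obtain S where S: "S \<subseteq> verts G" "card S = r"
    using obtain_subset_with_card_n[OF assms(3)] by metis
  then have "card (permutations_of_set S \<inter> edges G) = k"
    using assms(1) by (simp add: tournament_def)
  then obtain e where e: "e \<in> permutations_of_set S" "e \<in> edges G"
    using assms(2) by (metis Int_iff all_not_in_conv card.empty less_irrefl)
  then have dist: "distinct e" "set e = S" "length e = r"
    using S(2) by (auto simp: permutations_of_set_def distinct_card)
  \<comment> \<open>The path on \<open>r\<close> vertices has the single edge
    \<open>[0..<r]\<close>, so indexing into \<open>e\<close> is the embedding.\<close>
  have "map ((!) e) [0..<r] = e"
    using dist(3) map_nth by blast
  then show ?thesis
    using dist e(2) S(1)
    by (auto simp: contains_def tight_path_def intro!: exI[of _ "(!) e"] inj_on_nth)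
qed

lemma no_tight_path_of_second_peaks:
  assumes "\<And>xs. xs \<in> edges G \<Longrightarrow> second_peak xs" and "r \<ge> 3" and "r < s"
  shows "\<not> contains G (tight_path r s)"
proof
  assume "contains G (tight_path r s)"
  then obtain g where g: "\<forall>e \<in> edges (tight_path r s). map g e \<in> edges G"
    by (auto simp: contains_def)
  have "[i..<i + r] \<in> edges (tight_path r s)" if "i + r \<le> s" for i
    using that by (auto simp: tight_path_def)
  then have "map g [i..<i + r] \<in> edges G" if "i + r \<le> s" for i
    using g that by blast
  \<comment> \<open>The window starting at 1 exists because \<open>r < s\<close>. The two windows
    give \<open>g 2 < g 1\<close> and \<open>g 1 < g 2\<close>; both positions lie in both windows
    since \<open>r \<ge> 3\<close>.\<close>
  from this[of 0] this[of 1]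
  have "second_peak (map g [0..<r])" "second_peak (map g [1..<1 + r])"
    using assms(1,3) by auto
  then show False using assms(2) by (auto simp: second_peak_def simp del: upt_Suc)
qed

theorem proposition1:
  fixes n r k :: nat
  assumes "n \<ge> r" and "r \<ge> 1"
    and "0 < k" and "real k \<le> 1 / 3 * fact r"
  shows "f n r k = r"
proof -
  have "3 * real k \<le> real (fact r)" using assms(4) by simp
  then have k: "3 * k \<le> fact r" by linarith
  \<comment> \<open>For \<open>r \<le> 2\<close> the factorial is at most 2, whereas
    \<open>3 * k\<close> is at least 3.\<close>
  have r: "r \<ge> 3"
  proof (rule ccontr)
    assume "\<not> r \<ge> 3"
    then have "r = 1 \<or> r = 2" using assms(2) by linarith
    then show False using k assms(3) by (auto simp: fact_numeral)
  qed
  have "k \<le> card {xs \<in> permutations_of_set S. second_peak xs}"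
    if "S \<subseteq> {..<n}" "card S = r" for S
    using fact_le_three_card_second_peak[of S] finite_subset[OF that(1)] that(2) r k by simp
  \<comment> \<open>This one tournament supplies the upper bound on the path length; the lower bound
    must hold in every tournament.\<close>
  then obtain G where G: "tournament r k G" "verts G = {..<n}"
      "\<And>xs. xs \<in> edges G \<Longrightarrow> second_peak xs"
    using tournament_from_orderings[of "{..<n}" r k second_peak] by auto
  show ?thesis
    unfolding f_def
  proof (rule Greatest_equality)
    show "\<forall>G :: nat hyperdigraph.
        tournament r k G \<and> card (verts G) = n \<longrightarrow> contains G (tight_path r r)"
      using tournament_contains_edge assms(1-3) by blast
  next
    fix s
    assume "\<forall>G :: nat hyperdigraph.
        tournament r k G \<and> card (verts G) = n \<longrightarrow> contains G (tight_path r s)"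
    then have "contains G (tight_path r s)" using G(1,2) by simp
    then show "s \<le> r"
      using no_tight_path_of_second_peaks[OF G(3) r] by (meson not_le)
  qed
qed

end
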